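(* For every positive integer $n$, with $m = \lfloor (n-1)/2 \rfloor$, each of the polynomials $R_n^{D,>,\pm}(t)$, $R_n^{D,<,\pm}(t)$, $R_n^{B-D,>,\pm}(t)$ and $R_n^{B-D,<,\pm}(t)$ (eight polynomials in total, one for each choice of sign) is divisible by $(1+t)^m$.
   Context: $\mathfrak{B}_n$ is the set of signed permutations of $[n]$, written as words $\pi = \pi_1,\ldots,\pi_n$ with $\pi_i \in \{\pm 1,\ldots,\pm n\}$ and $|\pi_1|,\ldots,|\pi_n|$ a permutation of $[n]$. $\mathfrak{D}_n \subseteq \mathfrak{B}_n$ consists of those $\pi$ with an even number of negative entries. Set $\pi_0 = 0$. For $1 \leq i \leq n-1$, $\pi$ changes direction at $i$ if $\pi_{i-1} < \pi_i > \pi_{i+1}$ or $\pi_{i-1} > \pi_i < \pi_{i+1}$; $\mathrm{altruns}_D(\pi) = \mathrm{altruns}_B(\pi)$ is $1$ plus the number of such indices. Let $\mathsf{inv}_D(\pi) = |\{1 \le i<j \le n : \pi_i > \pi_j\}| + |\{1 \le i<j \le n : -\pi_i > \pi_j\}|$. For $X \in \{\mathfrak{D}_n, \mathfrak{B}_n - \mathfrak{D}_n\}$ let $X^> = \{\pi \in X : \pi_1 > 0\}$, $X^< = \{\pi \in X : \pi_1 < 0\}$, and for $\ast \in \{>,<\}$ let $X^{\ast,+}$ (resp. $X^{\ast,-}$) be the set of $\pi \in X^\ast$ with $\mathsf{inv}_D(\pi)$ even (resp. odd). Define $R_n^{D,\ast,\pm}(t) = \sum_{\pi \in \mathfrak{D}_n^{\ast,\pm}}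 t^{\mathrm{altruns}_D(\pi)}$ and $R_n^{B-D,\ast,\pm}(t) = \sum_{\pi \in (\mathfrak{B}_n-\mathfrak{D}_n)^{\ast,\pm}} t^{\mathrm{altruns}_D(\pi)}$. *)

theory Defs
  imports "HOL-Combinatorics.Multiset_Permutations" "HOL-Computational_Algebra.Polynomial"
begin

(* A signed permutation of {1..n} is the list of its entries pi_1, ..., pi_n. *)

definition signed_perms :: "nat \<Rightarrow> int list set" where
  "signed_perms n = {w. map abs w \<in> permutations_of_set {1..int n}}"

definition even_signed_perms :: "nat \<Rightarrow> int list set" where
  "even_signed_perms n = {w \<in> signed_perms n. even (length (filter (\<lambda>x. x < 0) w))}"

(* Lists are indexed from 0, so prepending 0 gives the 1-based entries
   together with the convention pi_0 = 0. *)

definition entry :: "int list \<Rightarrow> nat \<Rightarrow> int" where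
  "entry w i = (0 # w) ! i"

definition changes_direction :: "int list \<Rightarrow> nat \<Rightarrow> bool" where
  "changes_direction w i \<longleftrightarrow>
     (entry w (i - 1) < entry w i \<and> entry w i > entry w (i + 1)) \<or>
     (entry w (i - 1) > entry w i \<and> entry w i < entry w (i + 1))"

definition altruns_D :: "int list \<Rightarrow> nat" where
  "altruns_D w = 1 + card {i. 1 \<le> i \<and> i < length w \<and> changes_direction w i}"

definition inv_D :: "int list \<Rightarrow> nat" where
  "inv_D w =
     card {(i, j). 1 \<le> i \<and> i < j \<and> j \<le> length w \<and> entry w i > entry w j} +
     card {(i, j). 1 \<le> i \<and> i < j \<and> j \<le> length w \<and> - entry w i > entry w j}"

definition first_pos :: "int list set \<Rightarrow> int list set" where
  "first_pos X = {w \<in> X. entry w 1 > 0}"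

definition first_neg :: "int list set \<Rightarrow> int list set" where
  "first_neg X = {w \<in> X. entry w 1 < 0}"

definition inv_even :: "int list set \<Rightarrow> int list set" where
  "inv_even X = {w \<in> X. even (inv_D w)}"

definition inv_odd :: "int list set \<Rightarrow> int list set" where
  "inv_odd X = {w \<in> X. odd (inv_D w)}"

definition altruns_poly :: "int list set \<Rightarrow> int poly" where
  "altruns_poly X = (\<Sum>w\<in>X. monom 1 (altruns_D w))"

lemma length_signed_perms: "w \<in> signed_perms n \<Longrightarrow> length w = n"
  unfolding signed_perms_def
  using length_finite_permutations_of_set[of "map abs w" "{1..int n}"] by simp

(* So altruns_poly never takes the default value 0 of a sum over an
   infinite set when applied to subsets of signed_perms n. *)

lemma finite_signed_perms: "finite (signed_perms n)"
proof (rule finite_subset)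
  show "signed_perms n \<subseteq> {w. set w \<subseteq> {- int n..int n} \<and> length w = n}"
  proof (intro subsetI CollectI conjI)
    fix w x assume w: "w \<in> signed_perms n" and x: "x \<in> set w"
    have "set (map abs w) = {1..int n}"
      using w unfolding signed_perms_def mem_Collect_eq by (rule permutations_of_setD(1))
    moreover have "\<bar>x\<bar> \<in> set (map abs w)" using x by simp
    ultimately have "\<bar>x\<bar> \<in> {1..int n}" by blast
    then show "x \<in> {- int n..int n}" by auto
  qed (rule length_signed_perms)
  show "finite {w. set w \<subseteq> {- int n..int n} \<and> length w = n}"
    by (rule finite_lists_length_eq) simp
qed

end

theory Submission
  imports Defs
begin

text \<open>
  Negating all entries after position \<open>p\<close>, where \<open>1 \<le> p < n - 1\<close>, toggles exactly one of the direction
  changes at \<open>p\<close> and \<open>p + 1\<close>, and affects no other. Which of the two is toggled depends only on the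
  absolute values of the entries, so for the \<open>m\<close> values of \<open>p\<close> for which \<open>n - p\<close> is even these
  involutions toggle independent bits, and every orbit contributes \<open>t ^ a * (1 + t) ^ m\<close>. They
  preserve the sign of the first entry; they preserve the parity of the number of negative entries
  because an even number of entries is negated; and they preserve the parity of \<open>inv_D\<close> because it
  is the parity of the number of inversions of the absolute values.
\<close>

section \<open>Powers of 1 + t from independent toggling involutions\<close>

text \<open>Induction on \<open>K\<close>: the elements of \<open>S\<close> whose bit
  \<open>p\<close> is off form a set \<open>?T\<close> that is closed under the remaining
  \<open>f q\<close>, since these leave bit \<open>p\<close> alone. The map \<open>f p\<close>
  carries \<open>?T\<close> bijectively onto the rest of \<open>S\<close> and raises
  \<open>a\<close> by one, so the sum over \<open>S\<close> is 1 + t times the sum over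
  \<open>?T\<close>.\<close>

lemma power_dvd_sum_monom_toggles:
  fixes a :: "'a \<Rightarrow> nat"
  assumes "finite K" and "finite S"
    and "\<And>p w. p \<in> K \<Longrightarrow> w \<in> S \<Longrightarrow> f p w \<in> S"
    and "\<And>p w. p \<in> K \<Longrightarrow> w \<in> S \<Longrightarrow> f p (f p w) = w"
    and "\<And>p w. p \<in> K \<Longrightarrow> w \<in> S \<Longrightarrow> b p (f p w) \<longleftrightarrow> \<not> b p w"
    and "\<And>p q w. p \<in> K \<Longrightarrow> q \<in> K \<Longrightarrow> p \<noteq> q \<Longrightarrow> w \<in> S \<Longrightarrow> b q (f p w) \<longleftrightarrow> b q w"
    and "\<And>p w. p \<in> K \<Longrightarrow> w \<in> S \<Longrightarrow> \<not> b p w \<Longrightarrow> a (f p w) = Suc (a w)"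
  shows "[:1, 1:] ^ card K dvd (\<Sum>w\<in>S. monom (1 :: 'b :: comm_ring_1) (a w))"
  using assms
proof (induction K arbitrary: S rule: finite_induct)
  case empty
  then show ?case by simp
next
  case (insert p K)
  note closed = insert.prems(2) and invol = insert.prems(3) and toggle = insert.prems(4)
    and indep = insert.prems(5) and step = insert.prems(6)
  let ?T = "{w \<in> S. \<not> b p w}"
  have T_dvd: "[:1, 1:] ^ card K dvd (\<Sum>w\<in>?T. monom (1 :: 'b) (a w))"
  proof (rule insert.IH)
    show "finite ?T" using insert.prems(1) by simp
    fix q w assume q: "q \<in> K" and w: "w \<in> ?T"
    have "q \<noteq> p" using q insert.hyps by blast
    then show "f q w \<in> ?T" using closed[of q w] indep[of q p w] q w by auto
  qed (use invol toggle indep step in auto)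
  have image: "f p ` ?T = {w \<in> S. b p w}"
  proof (intro equalityI subsetI)
    fix w assume "w \<in> {w \<in> S. b p w}"
    then have "w = f p (f p w)" "f p w \<in> ?T" using closed toggle invol by auto
    then show "w \<in> f p ` ?T" by (rule image_eqI)
  qed (use closed toggle in auto)
  have inj: "inj_on (f p) ?T"
    by (rule inj_on_inverseI[where g = "f p"]) (use invol in auto)
  have "(\<Sum>w\<in>S. monom (1 :: 'b) (a w))
      = (\<Sum>w\<in>?T \<union> f p ` ?T. monom 1 (a w))"
    by (rule sum.cong) (auto simp: image)
  also have "\<dots> = (\<Sum>w\<in>?T. monom 1 (a w)) + (\<Sum>w\<in>f p ` ?T. monom 1 (a w))"
    by (rule sum.union_disjoint) (use insert.prems(1) image in auto)
  also have "(\<Sum>w\<in>f p ` ?T. monom (1 :: 'b) (a w)) = (\<Sum>w\<in>?T. monom 1 1 * monom 1 (a w))"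
    unfolding sum.reindex[OF inj] by (rule sum.cong) (auto simp: step mult_monom)
  also have "(\<Sum>w\<in>?T. monom (1 :: 'b) (a w)) + (\<Sum>w\<in>?T. monom 1 1 * monom 1 (a w))
      = [:1, 1:] * (\<Sum>w\<in>?T. monom 1 (a w))"
  proof -
    have "[:1, 1:] = 1 + monom (1 :: 'b) 1" by (simp add: monom_altdef one_pCons)
    then show ?thesis by (simp only: sum_distrib_left[symmetric] distrib_right mult_1_left)
  qed
  finally show ?case
    using T_dvd insert.hyps by (simp add: mult_dvd_mono del: mult_pCons_left)
qed

section \<open>Negating a suffix and its effect on direction changes\<close>

definition negate_after :: "nat \<Rightarrow> int list \<Rightarrow> int list" where
  "negate_after p w = take p w @ map uminus (drop p w)"

lemma length_negate_after [simp]: "length (negate_after p w) = length w"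
  by (simp add: negate_after_def)

lemma map_abs_negate_after [simp]: "map abs (negate_after p w) = map abs w"
proof -
  have "map abs (negate_after p w) = map abs (take p w @ drop p w)"
    unfolding negate_after_def map_append by simp
  then show ?thesis by (simp only: append_take_drop_id)
qed

lemma negate_after_negate_after [simp]: "negate_after p (negate_after p w) = w"
  by (cases "p \<le> length w") (simp_all add: negate_after_def comp_def)

lemma entry_negate_after:
  assumes "i \<le> length w"
  shows "entry (negate_after p w) i = (if i \<le> p then entry w i else - entry w i)"
  using assms by (cases i) (auto simp: entry_def negate_after_def nth_append min_def)

lemma abs_entry_negate_after:
  "i \<le> length w \<Longrightarrow> \<bar>entry (negate_after p w) i\<bar> = \<bar>entry w i\<bar>"
  by (simp add: entry_negate_after)

text \<open>Index 0 is included: the convention value 0 differs from all other absolute values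
  because these lie in 1, ..., n. Comparisons with the entry at index 0 thus need no separate
  treatment.\<close>

lemma abs_entry_eq_iff:
  assumes "w \<in> signed_perms n" "i \<le> n" "j \<le> n"
  shows "\<bar>entry w i\<bar> = \<bar>entry w j\<bar> \<longleftrightarrow> i = j"
proof -
  have perm: "map abs w \<in> permutations_of_set {1..int n}"
    using assms(1) by (simp add: signed_perms_def)
  have "distinct (0 # map abs w)"
    using permutations_of_setD[OF perm] by simp
  moreover have "\<bar>entry w k\<bar> = (0 # map abs w) ! k" if "k \<le> n" for k
    using that length_signed_perms[OF assms(1)] by (cases k) (auto simp: entry_def)
  moreover have "length (0 # map abs w) = Suc n"
    using length_signed_perms[OF assms(1)] by simp
  ultimately show ?thesis
    using assms(2,3) by (simp only: nth_eq_iff_index_eq less_Suc_eq_le)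
qed

text \<open>The order of two neighbours is decided by the sign of the one with larger absolute
  value. Negation therefore reverses all comparisons after \<open>p + 1\<close>, none before
  \<open>p\<close>, and the one between \<open>p\<close> and \<open>p + 1\<close> exactly when the
  entry at \<open>p + 1\<close> is larger in absolute value. A direction change is toggled only
  where an unreversed comparison meets a reversed one, which is at \<open>p\<close> in that case and
  at \<open>p + 1\<close> otherwise.\<close>

lemma changes_direction_negate_after:
  assumes w: "w \<in> signed_perms n" and p: "1 \<le> p" "p + 1 < n" and i: "1 \<le> i" "i < n"
  shows "changes_direction (negate_after p w) i \<longleftrightarrow>
    (changes_direction w i \<noteq>
      (i = (if \<bar>entry w p\<bar> < \<bar>entry w (p + 1)\<bar> then p else p + 1)))"
proof -
  have len: "length w = n" using w by (rule length_signed_perms)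
  have neq: "\<bar>entry w (i - 1)\<bar> \<noteq> \<bar>entry w i\<bar>" "\<bar>entry w i\<bar> \<noteq> \<bar>entry w (i + 1)\<bar>"
    using abs_entry_eq_iff[OF w] i by auto
  have neg: "entry (negate_after p w) j = (if j \<le> p then entry w j else - entry w j)"
    if "j \<le> i + 1" for j
    using that i len by (simp add: entry_negate_after)
  consider "i < p" | "i = p" | "i = p + 1" | "i > p + 1" by linarith
  then show ?thesis
  proof cases
    case 2
    then have "changes_direction (negate_after p w) i \<longleftrightarrow>
        (changes_direction w i \<noteq> (\<bar>entry w i\<bar> < \<bar>entry w (i + 1)\<bar>))"
      unfolding changes_direction_def using neq by (simp add: neg) linarith
    then show ?thesis using 2 by simp
  next
    case 3
    then have "changes_direction (negate_after p w) i \<longleftrightarrow>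
        (changes_direction w i \<noteq> (\<bar>entry w i\<bar> < \<bar>entry w (i - 1)\<bar>))"
      unfolding changes_direction_def using neq by (simp add: neg) linarith
    then show ?thesis using 3 neq by auto
  qed (auto simp: changes_direction_def neg)
qed

lemma altruns_D_negate_after:
  assumes w: "w \<in> signed_perms n" and p: "1 \<le> p" "p + 1 < n"
    and "\<not> changes_direction w (if \<bar>entry w p\<bar> < \<bar>entry w (p + 1)\<bar> then p else p + 1)"
  shows "altruns_D (negate_after p w) = Suc (altruns_D w)"
proof -
  let ?k = "if \<bar>entry w p\<bar> < \<bar>entry w (p + 1)\<bar> then p else p + 1"
  have len: "length w = n" using w by (rule length_signed_perms)
  \<comment> \<open>By \<open>p + 1 < n\<close> both candidates for the toggled position lie in the
    range that \<open>altruns_D\<close> counts.\<close>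
  have k: "1 \<le> ?k" "?k < n" using p by auto
  have "{i. 1 \<le> i \<and> i < n \<and> changes_direction (negate_after p w) i}
      = insert ?k {i. 1 \<le> i \<and> i < n \<and> changes_direction w i}"
    using changes_direction_negate_after[OF w p] assms(4) k by (auto split del: if_split)
  then show ?thesis
    using assms(4) by (simp add: altruns_D_def len split del: if_split)
qed

section \<open>The admissible cut positions and the divisibility criterion\<close>

text \<open>All members have the parity of \<open>n\<close>, so the pairs \<open>p\<close>,
  \<open>p + 1\<close> of possible toggle positions are disjoint for different \<open>p\<close>.
  Parity also excludes \<open>p = n - 1\<close>.\<close>

definition even_suffixes :: "nat \<Rightarrow> nat set" where
  "even_suffixes n = {p. 1 \<le> p \<and> p < n \<and> even (n - p)}"

lemma finite_even_suffixes: "finite (even_suffixes n)"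
  by (rule finite_subset[of _ "{..<n}"]) (auto simp: even_suffixes_def)

lemma even_suffixesD:
  assumes "p \<in> even_suffixes n"
  shows "1 \<le> p" "p + 1 < n" "even (n - p)"
proof -
  show "p + 1 < n"
  proof (rule ccontr)
    assume "\<not> p + 1 < n"
    then have "n - p = 1" using assms by (auto simp: even_suffixes_def)
    moreover have "even (n - p)" using assms by (simp only: even_suffixes_def mem_Collect_eq)
    ultimately show False by (simp only: odd_one)
  qed
qed (use assms in \<open>auto simp: even_suffixes_def\<close>)

lemma card_even_suffixes: "card (even_suffixes n) = (n - 1) div 2"
proof -
  \<comment> \<open>The members are n - 2, n - 4, and so on down to 1 or 2. The bound on
    \<open>j\<close> says exactly that \<open>n - 2 * (j + 1)\<close> is at least 1, so the
    subtraction never truncates and the map is injective.\<close>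
  have "even_suffixes n = (\<lambda>j. n - 2 * (j + 1)) ` {..<(n - 1) div 2}"
  proof (intro equalityI subsetI)
    fix p assume p: "p \<in> even_suffixes n"
    then obtain c where c: "n - p = 2 * c" using even_suffixesD(3) by (blast elim: evenE)
    have "p = n - 2 * (c - 1 + 1)" "c - 1 < (n - 1) div 2"
      using c even_suffixesD[OF p] by auto
    then show "p \<in> (\<lambda>j. n - 2 * (j + 1)) ` {..<(n - 1) div 2}" by blast
  qed (auto simp: even_suffixes_def)
  moreover have "inj_on (\<lambda>j. n - 2 * (j + 1)) {..<(n - 1) div 2}"
    by (rule inj_onI) auto
  ultimately show ?thesis by (simp add: card_image)
qed

definition negation_closed :: "nat \<Rightarrow> int list set \<Rightarrow> bool" where
  "negation_closed n X \<longleftrightarrow> X \<subseteq> signed_perms n \<and>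
     (\<forall>w \<in> X. \<forall>p \<in> even_suffixes n. negate_after p w \<in> X)"

lemma power_dvd_altruns_poly:
  assumes "negation_closed n X"
  shows "[:1, 1:] ^ ((n - 1) div 2) dvd altruns_poly X"
proof -
  \<comment> \<open>The single position that \<open>negate_after p\<close> toggles. It is a function
    of absolute values, hence unchanged by every \<open>negate_after q\<close>, and the bit attached
    to \<open>p\<close> is read at the same place before and after.\<close>
  define k where
    "k p w = (if \<bar>entry w p\<bar> < \<bar>entry w (p + 1)\<bar> then p else p + 1)" for p w
  have perm: "w \<in> signed_perms n" if "w \<in> X" for w
    using assms that by (auto simp: negation_closed_def)
  have k_inv: "k q (negate_after p w) = k q w"
    if "p \<in> even_suffixes n" "q \<in> even_suffixes n" "w \<in> X" for p q w
    using even_suffixesD(2)[OF that(2)] length_signed_perms[OF perm[OF that(3)]]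
    by (simp add: k_def abs_entry_negate_after)
  \<comment> \<open>For \<open>q = p\<close> this is the toggling of the bit; for
    \<open>q \<noteq> p\<close>, together with \<open>k_neq\<close>, it is the independence of the
    bits.\<close>
  have bit: "changes_direction (negate_after p w) (k q w) \<longleftrightarrow>
      changes_direction w (k q w) \<noteq> (k q w = k p w)"
    if "p \<in> even_suffixes n" "q \<in> even_suffixes n" "w \<in> X" for p q w
    using changes_direction_negate_after[OF perm[OF that(3)] even_suffixesD(1,2)[OF that(1)]]
      even_suffixesD(1,2)[OF that(2)]
    by (simp add: k_def)
  have k_neq: "k q w \<noteq> k p w"
    if "p \<in> even_suffixes n" "q \<in> even_suffixes n" "p \<noteq> q" for p q w
  proof -
    have "even p \<longleftrightarrow> even q"
      using that(1,2) by (auto simp: even_suffixes_def)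
    then have "q \<noteq> p + 1" "p \<noteq> q + 1" by auto
    then show ?thesis using that(3) by (simp add: k_def)
  qed
  have step: "altruns_D (negate_after p w) = Suc (altruns_D w)"
    if "p \<in> even_suffixes n" "w \<in> X" "\<not> changes_direction w (k p w)" for p w
    using altruns_D_negate_after[OF perm even_suffixesD(1,2)] that unfolding k_def by blast
  have "[:1, 1:] ^ card (even_suffixes n) dvd (\<Sum>w\<in>X. monom (1 :: int) (altruns_D w))"
  proof (rule power_dvd_sum_monom_toggles
      [where f = negate_after and b = "\<lambda>p w. changes_direction w (k p w)"])
    show "finite X"
      using assms finite_signed_perms by (auto simp: negation_closed_def intro: finite_subset)
  qed (use assms k_inv bit k_neq step
        in \<open>auto simp: finite_even_suffixes negation_closed_def\<close>)
  then show ?thesis by (simp add: altruns_poly_def card_even_suffixes)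
qed

section \<open>Invariance of the parities and of the first sign\<close>

text \<open>For a pair with distinct absolute values, the first is larger in absolute value iff
  exactly one of the two inequalities counted by \<open>inv_D\<close> holds. So \<open>C\<close> is
  the symmetric difference of \<open>A\<close> and \<open>B\<close>, and its size agrees modulo 2
  with the sum of theirs.\<close>

lemma even_inv_D_iff:
  assumes "w \<in> signed_perms n"
  shows "even (inv_D w) \<longleftrightarrow>
    even (card {(i, j). 1 \<le> i \<and> i < j \<and> j \<le> n \<and> \<bar>entry w i\<bar> > \<bar>entry w j\<bar>})"
proof -
  have len: "length w = n" using assms by (rule length_signed_perms)
  define A where "A = {(i, j). 1 \<le> i \<and> i < j \<and> j \<le> n \<and> entry w i > entry w j}"
  define B where "B = {(i, j). 1 \<le> i \<and> i < j \<and> j \<le> n \<and> - entry w i > entry w j}"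
  define C where "C = {(i, j). 1 \<le> i \<and> i < j \<and> j \<le> n \<and> \<bar>entry w i\<bar> > \<bar>entry w j\<bar>}"
  have fin: "finite A" "finite B"
    by (rule finite_subset[of _ "{..n} \<times> {..n}"]; auto simp: A_def B_def)+
  have "\<bar>entry w i\<bar> > \<bar>entry w j\<bar> \<longleftrightarrow> (entry w i > entry w j) \<noteq> (- entry w i > entry w j)"
    if "1 \<le> i" "i < j" "j \<le> n" for i j
  proof -
    have "\<bar>entry w i\<bar> \<noteq> \<bar>entry w j\<bar>" using abs_entry_eq_iff[OF assms, of i j] that by simp
    then show ?thesis by linarith
  qed
  then have C: "C = (A \<union> B) - (A \<inter> B)"
    unfolding A_def B_def C_def by blast
  have "card C = card (A \<union> B) - card (A \<inter> B)"
    unfolding C using fin by (intro card_Diff_subset) auto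
  \<comment> \<open>This makes the natural-number subtraction above exact.\<close>
  moreover have "card (A \<inter> B) \<le> card (A \<union> B)"
    using fin by (intro card_mono) auto
  ultimately have "card A + card B = card C + 2 * card (A \<inter> B)"
    using card_Un_Int[OF fin] by linarith
  then have "even (card A + card B) \<longleftrightarrow> even (card C)" by simp
  then show ?thesis by (simp only: inv_D_def len A_def B_def C_def)
qed

lemma even_inv_D_negate_after:
  assumes "w \<in> signed_perms n"
  shows "even (inv_D (negate_after p w)) \<longleftrightarrow> even (inv_D w)"
proof -
  have "negate_after p w \<in> signed_perms n" using assms by (simp add: signed_perms_def)
  moreover have "{(i, j). 1 \<le> i \<and> i < j \<and> j \<le> n \<and>
        \<bar>entry (negate_after p w) i\<bar> > \<bar>entry (negate_after p w) j\<bar>}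
      = {(i, j). 1 \<le> i \<and> i < j \<and> j \<le> n \<and> \<bar>entry w i\<bar> > \<bar>entry w j\<bar>}"
    using length_signed_perms[OF assms] by (auto simp: abs_entry_negate_after)
  ultimately show ?thesis using even_inv_D_iff assms by simp
qed

lemma length_filter_neg_map_uminus:
  fixes xs :: "int list"
  assumes "0 \<notin> set xs"
  shows "length (filter (\<lambda>x. x < 0) (map uminus xs)) + length (filter (\<lambda>x. x < 0) xs) = length xs"
  using assms by (induction xs) auto

text \<open>No entry is 0, so negating a suffix of length L with k negative entries leaves L - k
  negative ones, and L - k has the parity of k because L is even.\<close>

lemma even_neg_count_negate_after:
  assumes "w \<in> signed_perms n" "p \<in> even_suffixes n"
  shows "even (length (filter (\<lambda>x. x < 0) (negate_after p w))) \<longleftrightarrow>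
    even (length (filter (\<lambda>x. x < 0) w))"
proof -
  let ?neg = "\<lambda>xs :: int list. length (filter (\<lambda>x. x < 0) xs)"
  have "set (map abs w) = {1..int n}"
    using assms(1) unfolding signed_perms_def mem_Collect_eq by (rule permutations_of_setD(1))
  moreover have "0 \<in> set (map abs w)" if "0 \<in> set w" using that by force
  ultimately have "0 \<notin> set w" by auto
  then have "0 \<notin> set (drop p w)" using in_set_dropD by fast
  moreover have "even (length (drop p w))"
    using assms(1) even_suffixesD(3)[OF assms(2)] by (simp only: length_drop length_signed_perms)
  ultimately have "even (?neg (map uminus (drop p w)) + ?neg (drop p w))"
    by (subst length_filter_neg_map_uminus)
  moreover have "?neg (negate_after p w) = ?neg (take p w) + ?neg (map uminus (drop p w))"
    by (simp only: negate_after_def filter_append length_append)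
  moreover have "?neg w = ?neg (take p w) + ?neg (drop p w)"
    by (metis append_take_drop_id filter_append length_append)
  ultimately show ?thesis by presburger
qed

lemma negation_closed_even_signed_perms: "negation_closed n (even_signed_perms n)"
  by (auto simp: negation_closed_def even_signed_perms_def even_neg_count_negate_after)
    (simp add: signed_perms_def)

lemma negation_closed_odd_signed_perms:
  "negation_closed n (signed_perms n - even_signed_perms n)"
  by (auto simp: negation_closed_def even_signed_perms_def even_neg_count_negate_after)
    (simp add: signed_perms_def)

lemma entry_1_negate_after:
  "w \<in> signed_perms n \<Longrightarrow> p \<in> even_suffixes n \<Longrightarrow> entry (negate_after p w) 1 = entry w 1"
  using even_suffixesD(1,2)[of p n] by (simp add: entry_negate_after length_signed_perms)

lemma negation_closed_first_pos: "negation_closed n X \<Longrightarrow> negation_closed n (first_pos X)"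
  by (auto simp: negation_closed_def first_pos_def entry_1_negate_after subset_iff simp del: One_nat_def)

lemma negation_closed_first_neg: "negation_closed n X \<Longrightarrow> negation_closed n (first_neg X)"
  by (auto simp: negation_closed_def first_neg_def entry_1_negate_after subset_iff simp del: One_nat_def)

lemma negation_closed_inv_even: "negation_closed n X \<Longrightarrow> negation_closed n (inv_even X)"
  by (auto simp: negation_closed_def inv_even_def even_inv_D_negate_after subset_iff)

lemma negation_closed_inv_odd: "negation_closed n X \<Longrightarrow> negation_closed n (inv_odd X)"
  by (auto simp: negation_closed_def inv_odd_def even_inv_D_negate_after subset_iff)

theorem theorem17:
  fixes n m :: nat
  assumes "n \<ge> 1" and "m = (n - 1) div 2"
  shows
    "[:1, 1:] ^ m dvd altruns_poly (inv_even (first_pos (even_signed_perms n))) \<and>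
     [:1, 1:] ^ m dvd altruns_poly (inv_odd (first_pos (even_signed_perms n))) \<and>
     [:1, 1:] ^ m dvd altruns_poly (inv_even (first_neg (even_signed_perms n))) \<and>
     [:1, 1:] ^ m dvd altruns_poly (inv_odd (first_neg (even_signed_perms n))) \<and>
     [:1, 1:] ^ m dvd altruns_poly (inv_even (first_pos (signed_perms n - even_signed_perms n))) \<and>
     [:1, 1:] ^ m dvd altruns_poly (inv_odd (first_pos (signed_perms n - even_signed_perms n))) \<and>
     [:1, 1:] ^ m dvd altruns_poly (inv_even (first_neg (signed_perms n - even_signed_perms n))) \<and>
     [:1, 1:] ^ m dvd altruns_poly (inv_odd (first_neg (signed_perms n - even_signed_perms n)))"
  \<comment> \<open>Each of the eight sets arises from the even signed permutations or their
    complement by restricting the first sign and then the parity of \<open>inv_D\<close>; both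
    restrictions preserve \<open>negation_closed\<close>.\<close>
  unfolding assms(2)
  by (intro conjI power_dvd_altruns_poly negation_closed_inv_even negation_closed_inv_odd
      negation_closed_first_pos negation_closed_first_neg
      negation_closed_even_signed_perms negation_closed_odd_signed_perms)

end
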